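(* Let $n\geq 3$. For every $\epsilon>0$ there exists a measurable set $E\subset\mathbb{R}^n$ with $[0,1]^n\subset E\subset[-\epsilon,1+\epsilon]^n$ such that $E$ tiles $\mathbb{R}^n$ by translations, but $E$ admits no tiling by translations whose translation set is a lattice.
   Context: A measurable set $E\subset\mathbb{R}^n$ with $0<|E|<\infty$ tiles $\mathbb{R}^n$ by translations if there is a discrete set $T\subset\mathbb{R}^n$ such that, up to sets of measure zero, the sets $E+t$, $t\in T$, are pairwise disjoint and their union is $\mathbb{R}^n$; $T$ is the translation set. A lattice in $\mathbb{R}^n$ is a set of the form $A\mathbb{Z}^n$ with $A$ an invertible linear map of $\mathbb{R}^n$. *)

theory Defs
  imports "HOL-Analysis.Analysis"
begin

definition discrete_set :: "'a::metric_space set \<Rightarrow> bool" where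
  "discrete_set T \<longleftrightarrow> (\<forall>x\<in>T. \<exists>e>0. \<forall>y\<in>T. y \<noteq> x \<longrightarrow> dist x y \<ge> e)"

definition tiles_with :: "('a::euclidean_space) set \<Rightarrow> 'a set \<Rightarrow> bool" where
  "tiles_with E T \<longleftrightarrow>
     E \<in> sets lebesgue \<and> 0 < emeasure lebesgue E \<and> emeasure lebesgue E < \<infinity> \<and>
     discrete_set T \<and>
     (\<forall>s\<in>T. \<forall>t\<in>T. s \<noteq> t \<longrightarrow> ((\<lambda>x. x + s) ` E) \<inter> ((\<lambda>x. x + t) ` E) \<in> null_sets lebesgue) \<and>
     UNIV - (\<Union>t\<in>T. (\<lambda>x. x + t) ` E) \<in> null_sets lebesgue"

definition tiles :: "('a::euclidean_space) set \<Rightarrow> bool" where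
  "tiles E \<longleftrightarrow> (\<exists>T. tiles_with E T)"

definition is_lattice :: "(real^'n) set \<Rightarrow> bool" where
  "is_lattice L \<longleftrightarrow> (\<exists>A :: real^'n^'n. invertible A \<and>
      L = (\<lambda>z. A *v z) ` {z. \<forall>i. z $ i \<in> \<int>})"

end

(*
Start from the tiling of space by unit cubes arranged in columns in one direction a, the column in
position (i,j) of two further directions b, c being shifted by floor((i+j)/2)/2 along a. Cut small
boxes out of the cube and reattach them on the opposite side, in such a way that the tiling survives:
moving a box by a period of the tiling is harmless, and so is moving across the b-face a pair of
boxes that is invariant under the half shift along a. The dents can only be filled by the matching
bumps. In a lattice tiling this forces the lattice to contain the periods e_k (k different from b, c),
e_a/2 + e_b + e_c and e_b - e_c; a neighbour across the b-face is then half of e_a/2 + 2 e_b modulo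
these periods, so it is shifted by 1/4 or 3/4 along a, and the pair of boxes on that face does not fit.
Since all boxes are half-open, a tiling up to null sets covers every point exactly once.
*)
theory Submission
  imports Defs
begin

subsection \<open>Half-open boxes and exact tilings\<close>

definition hbox :: "real \<Rightarrow> real^'n \<Rightarrow> (real^'n) set" where
  "hbox d p = {x. \<forall>k. p $ k \<le> x $ k \<and> x $ k < p $ k + d}"

lemma hbox_translate: "x - v \<in> hbox d p \<longleftrightarrow> x \<in> hbox d (p + v)"
  by (auto simp: hbox_def algebra_simps)

lemma hbox_borel: "hbox d (p :: real^'n) \<in> sets borel"
proof -
  have "hbox d p = (\<Inter>k. {x. p $ k \<le> x $ k} \<inter> {x. x $ k < p $ k + d})"
    by (auto simp: hbox_def)
  moreover have "{x :: real^'n. p $ k \<le> x $ k} \<in> sets borel" for k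
    by (intro borel_closed closed_Collect_le continuous_intros)
  moreover have "{x :: real^'n. x $ k < p $ k + d} \<in> sets borel" for k
    by (intro borel_open open_Collect_less continuous_intros)
  ultimately show ?thesis
    by auto
qed

lemma hbox_subset_cbox: "hbox d p \<subseteq> cbox p (p + vec d)"
  by (auto simp: hbox_def mem_box_cart less_imp_le)

lemma hbox_not_null:
  assumes "0 < d" "hbox d (p :: real^'n) \<subseteq> N"
  shows "N \<notin> null_sets lebesgue"
proof
  assume "N \<in> null_sets lebesgue"
  moreover have "box p (p + vec d) \<subseteq> N"
    using assms(2) by (auto simp: hbox_def mem_box_cart less_imp_le)
  ultimately have "negligible (box p (p + vec d))"
    using negligible_iff_null_sets negligible_subset by blast
  moreover have "box p (p + vec d) \<noteq> {}"
    using assms(1) by (subst interval_ne_empty_cart) auto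
  ultimately show False
    using open_not_negligible open_box by blast
qed

text \<open>Clopen sets of the product of Sorgenfrey lines. For such sets, statements that hold up to
  null sets hold everywhere.\<close>

definition right_clopen :: "(real^'n) set \<Rightarrow> bool" where
  "right_clopen A \<longleftrightarrow> (\<forall>x. \<exists>h>0. \<forall>y\<in>hbox h x. y \<in> A \<longleftrightarrow> x \<in> A)"

lemma hbox_mono: "h \<le> h' \<Longrightarrow> hbox h x \<subseteq> hbox h' x"
  unfolding hbox_def by (auto intro: less_le_trans)

lemma right_clopen_Compl: "right_clopen A \<Longrightarrow> right_clopen (- A)"
  by (simp add: right_clopen_def)

lemma right_clopen_Int:
  assumes "right_clopen A" "right_clopen B"
  shows "right_clopen (A \<inter> B)"
  unfolding right_clopen_def
proof
  fix x
  obtain h1 h2 where "h1 > 0" "\<forall>y\<in>hbox h1 x. y \<in> A \<longleftrightarrow> x \<in> A"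
    "h2 > 0" "\<forall>y\<in>hbox h2 x. y \<in> B \<longleftrightarrow> x \<in> B"
    using assms unfolding right_clopen_def by meson
  then show "\<exists>h>0. \<forall>y\<in>hbox h x. y \<in> A \<inter> B \<longleftrightarrow> x \<in> A \<inter> B"
    using hbox_mono[of "min h1 h2" h1 x] hbox_mono[of "min h1 h2" h2 x]
    by (intro exI[of _ "min h1 h2"]) auto
qed

lemma right_clopen_Un: "right_clopen A \<Longrightarrow> right_clopen B \<Longrightarrow> right_clopen (A \<union> B)"
  using right_clopen_Compl[OF right_clopen_Int[OF right_clopen_Compl right_clopen_Compl]]
  by fastforce

lemma right_clopen_UN:
  assumes "finite I" "\<And>i. i \<in> I \<Longrightarrow> right_clopen (A i)"
  shows "right_clopen (\<Union>i\<in>I. A i)"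
  using assms
proof (induction I rule: finite_induct)
  case empty
  then show ?case
    by (auto simp: right_clopen_def intro: exI[of _ 1])
next
  case (insert i I)
  then show ?case
    by (simp add: right_clopen_Un)
qed

lemma right_clopen_INT:
  assumes "finite I" "\<And>i. i \<in> I \<Longrightarrow> right_clopen (A i)"
  shows "right_clopen (\<Inter>i\<in>I. A i)"
  using right_clopen_Compl[OF right_clopen_UN[OF assms(1), of "\<lambda>i. - A i"]]
    assms(2) right_clopen_Compl by fastforce

lemma right_clopen_halfspace: "right_clopen {x :: real^'n. s \<le> x $ k}"
  unfolding right_clopen_def
proof
  fix x :: "real^'n"
  show "\<exists>h>0. \<forall>y\<in>hbox h x. y \<in> {x. s \<le> x $ k} \<longleftrightarrow> x \<in> {x. s \<le> x $ k}"
  proof (cases "s \<le> x $ k")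
    case True
    then show ?thesis
      by (intro exI[of _ 1]) (auto simp: hbox_def intro: order_trans)
  next
    case False
    then show ?thesis
      by (intro exI[of _ "s - x $ k"]) (auto simp: hbox_def not_le dest!: spec[of _ k])
  qed
qed

lemma right_clopen_hbox: "right_clopen (hbox d (p :: real^'n))"
proof -
  have "hbox d p = (\<Inter>k. {x. p $ k \<le> x $ k} \<inter> - {x. p $ k + d \<le> x $ k})"
    by (auto simp: hbox_def simp flip: not_le)
  then show ?thesis
    by (auto intro!: right_clopen_INT right_clopen_Int right_clopen_Compl right_clopen_halfspace)
qed

text \<open>Positive scaling preserves the orientation of half-open boxes, so the property survives
  the rescaling used at the end.\<close>

lemma right_clopen_affine_vimage:
  assumes "right_clopen A" "0 < r"
  shows "right_clopen {x. r *\<^sub>R x + w \<in> A}"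
  unfolding right_clopen_def
proof
  fix x
  obtain h where h: "h > 0" "\<forall>y\<in>hbox h (r *\<^sub>R x + w). y \<in> A \<longleftrightarrow> r *\<^sub>R x + w \<in> A"
    using assms unfolding right_clopen_def by meson
  have "r *\<^sub>R y + w \<in> hbox h (r *\<^sub>R x + w)" if "y \<in> hbox (h / r) x" for y
    using that assms(2) unfolding hbox_def
    by (auto simp: field_simps)
  then show "\<exists>h>0. \<forall>y\<in>hbox h x. y \<in> {x. r *\<^sub>R x + w \<in> A} \<longleftrightarrow> x \<in> {x. r *\<^sub>R x + w \<in> A}"
    using h assms(2) by (intro exI[of _ "h / r"]) auto
qed

lemma right_clopen_translate: "right_clopen A \<Longrightarrow> right_clopen {x. x - v \<in> A}"
  using right_clopen_affine_vimage[of A 1 "- v"] by simp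

section \<open>Lattices: local finiteness and exactness of their tilings\<close>

lemma finite_integer_vectors: "finite {z :: real^'n. \<forall>i. z $ i \<in> \<int> \<and> \<bar>z $ i\<bar> \<le> R}"
proof -
  let ?I = "{u :: real. u \<in> \<int> \<and> \<bar>u\<bar> \<le> R}"
  have "finite (Pi\<^sub>E UNIV (\<lambda>_ :: 'n. ?I))"
    by (intro finite_PiE finite_abs_int_segment) auto
  then have "finite ((\<lambda>f. \<chi> i. f i) ` (Pi\<^sub>E UNIV (\<lambda>_ :: 'n. ?I)) :: (real^'n) set)"
    by simp
  moreover have "{z :: real^'n. \<forall>i. z $ i \<in> \<int> \<and> \<bar>z $ i\<bar> \<le> R}
      \<subseteq> (\<lambda>f. \<chi> i. f i) ` (Pi\<^sub>E UNIV (\<lambda>_ :: 'n. ?I))"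
  proof
    fix z :: "real^'n"
    assume "z \<in> {z :: real^'n. \<forall>i. z $ i \<in> \<int> \<and> \<bar>z $ i\<bar> \<le> R}"
    then show "z \<in> (\<lambda>f. \<chi> i. f i) ` (Pi\<^sub>E UNIV (\<lambda>_ :: 'n. ?I))"
      by (intro image_eqI[of _ _ "\<lambda>i. z $ i"]) auto
  qed
  ultimately show ?thesis
    using finite_subset by blast
qed

text \<open>The inverse matrix bounds the integer coordinates of a lattice vector by a multiple of
  its norm.\<close>

lemma is_lattice_finite_bounded:
  fixes L :: "(real^'n) set"
  assumes "is_lattice L"
  shows "finite {l \<in> L. norm l \<le> R}"
proof -
  obtain A :: "real^'n^'n" where A: "invertible A" "L = (\<lambda>z. A *v z) ` {z. \<forall>i. z $ i \<in> \<int>}"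
    using assms unfolding is_lattice_def by blast
  then obtain B where B: "B ** A = mat 1"
    using invertible_def by blast
  obtain K where K: "\<And>x. norm (B *v x) \<le> norm x * K" "K > 0"
    using bounded_linear.pos_bounded[OF matrix_vector_mul_bounded_linear[of B]] by blast
  have "{l \<in> L. norm l \<le> R} \<subseteq> (\<lambda>z. A *v z) ` {z. \<forall>i. z $ i \<in> \<int> \<and> \<bar>z $ i\<bar> \<le> R * K}"
  proof
    fix l
    assume "l \<in> {l \<in> L. norm l \<le> R}"
    then obtain z where z: "l = A *v z" "\<forall>i. z $ i \<in> \<int>" "norm l \<le> R"
      using A by auto
    have "z = B *v l"
      using z B by (simp add: matrix_vector_mul_assoc)
    then have "norm z \<le> R * K"
      using K(1)[of l] K(2) z(3) by (smt (verit) mult_right_mono)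
    then have "\<bar>z $ i\<bar> \<le> R * K" for i
      using component_le_norm_cart[of z i] by linarith
    then show "l \<in> (\<lambda>z. A *v z) ` {z. \<forall>i. z $ i \<in> \<int> \<and> \<bar>z $ i\<bar> \<le> R * K}"
      using z by auto
  qed
  then show ?thesis
    using finite_integer_vectors finite_subset by blast
qed

lemma is_lattice_zero: "is_lattice L \<Longrightarrow> 0 \<in> L"
  unfolding is_lattice_def by (force intro: image_eqI[of _ _ 0])

lemma is_lattice_diff: "is_lattice L \<Longrightarrow> x \<in> L \<Longrightarrow> y \<in> L \<Longrightarrow> x - y \<in> L"
  unfolding is_lattice_def
  by (force simp flip: matrix_vector_mult_diff_distrib)

text \<open>An overlap of two translates is right-clopen, so one common point brings a half-open box
  of positive measure. An uncovered point does the same once the relevant translates are cut down to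
  finitely many.\<close>

lemma lattice_tiling_exact:
  fixes A :: "(real^'n) set"
  assumes A: "right_clopen A" "bounded A" and L: "is_lattice L" "tiles_with A L"
  shows "\<exists>!l. l \<in> L \<and> x - l \<in> A"
proof -
  have shift: "(\<lambda>x. x + l) ` A = {x. x - l \<in> A}" for l
    by (auto intro: image_eqI[of _ _ "_ - l"])
  have "l = l'" if "l \<in> L" "x - l \<in> A" "l' \<in> L" "x - l' \<in> A" for l l'
  proof (rule ccontr)
    assume "l \<noteq> l'"
    then have "{x. x - l \<in> A} \<inter> {x. x - l' \<in> A} \<in> null_sets lebesgue"
      using L(2) that unfolding tiles_with_def shift by blast
    moreover have "right_clopen ({x. x - l \<in> A} \<inter> {x. x - l' \<in> A})"
      by (intro right_clopen_Int right_clopen_translate A)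
    then obtain h where "h > 0"
      "\<forall>y\<in>hbox h x. y \<in> {x. x - l \<in> A} \<inter> {x. x - l' \<in> A} \<longleftrightarrow> x \<in> {x. x - l \<in> A} \<inter> {x. x - l' \<in> A}"
      unfolding right_clopen_def by meson
    moreover from this have "hbox h x \<subseteq> {x. x - l \<in> A} \<inter> {x. x - l' \<in> A}"
      using that by auto
    ultimately show False
      using hbox_not_null by blast
  qed
  moreover have "\<exists>l. l \<in> L \<and> x - l \<in> A"
  proof (rule ccontr)
    assume *: "\<nexists>l. l \<in> L \<and> x - l \<in> A"
    obtain R where R: "\<And>y. y \<in> A \<Longrightarrow> norm y \<le> R"
      using A(2) unfolding bounded_iff by blast
    obtain S where S: "\<And>y. y \<in> hbox 1 x \<Longrightarrow> norm y \<le> S"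
    proof -
      have "hbox 1 x \<subseteq> cbox x (x + vec 1)"
        by (rule hbox_subset_cbox)
      then have "bounded (hbox 1 x)"
        using bounded_cbox bounded_subset by blast
      then show thesis
        using that unfolding bounded_iff by blast
    qed
    \<comment> \<open>Only these translates of \<open>A\<close> can meet \<open>hbox 1 x\<close>,
      since \<open>norm l\<close> is at most \<open>norm y + norm (y - l)\<close>.\<close>
    define N where "N = {l \<in> L. norm l \<le> R + S}"
    have "right_clopen (\<Union>l\<in>N. {x. x - l \<in> A})"
      using is_lattice_finite_bounded[OF L(1)] unfolding N_def
      by (intro right_clopen_UN right_clopen_translate A)
    then obtain h where h: "h > 0"
      "\<And>y. y \<in> hbox h x \<Longrightarrow> y \<in> (\<Union>l\<in>N. {x. x - l \<in> A}) \<longleftrightarrow> x \<in> (\<Union>l\<in>N. {x. x - l \<in> A})"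
      unfolding right_clopen_def by meson
    have "hbox (min h 1) x \<subseteq> UNIV - (\<Union>l\<in>L. {x. x - l \<in> A})"
    proof
      fix y
      assume y: "y \<in> hbox (min h 1) x"
      have "l \<in> N" if "l \<in> L" "y - l \<in> A" for l
        using R[OF that(2)] S[of y] y hbox_mono[of "min h 1" 1 x] norm_triangle_ineq4[of y "y - l"] that(1)
        unfolding N_def by auto
      moreover have "y \<notin> (\<Union>l\<in>N. {x. x - l \<in> A})"
        using h(2)[of y] y hbox_mono[of "min h 1" h x] * unfolding N_def by auto
      ultimately show "y \<in> UNIV - (\<Union>l\<in>L. {x. x - l \<in> A})"
        by blast
    qed
    then show False
      using hbox_not_null[of "min h 1"] h(1) L(2) unfolding tiles_with_def shift by auto
  qed
  ultimately show ?thesis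
    by blast
qed

lemma exact_imp_tiles:
  fixes A :: "(real^'n) set"
  assumes "A \<in> sets borel" "bounded A" "cbox (vec 0) (vec 1) \<subseteq> A"
    and "discrete_set T" "\<And>x. \<exists>!t. t \<in> T \<and> x - t \<in> A"
  shows "tiles A"
proof -
  have shift: "(\<lambda>x. x + l) ` A = {x. x - l \<in> A}" for l
    by (auto intro: image_eqI[of _ _ "_ - l"])
  have meas: "A \<in> sets lebesgue"
    using assms(1) sets_completionI_sets[of A lborel] by simp
  have "hbox 1 0 \<subseteq> cbox (vec 0) (vec 1 :: real^'n)"
    using hbox_subset_cbox[of 1 "0 :: real^'n"] by (simp add: vec_0)
  then have "hbox 1 0 \<subseteq> A"
    using assms(3) by blast
  then have "A \<notin> null_sets lebesgue"
    by (intro hbox_not_null) auto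
  then have pos: "0 < emeasure lebesgue A"
    using meas by (auto simp: null_sets_def zero_less_iff_neq_zero)
  have "emeasure lebesgue A = emeasure lborel A"
    using assms(1) by simp
  also have "\<dots> < \<infinity>"
    using emeasure_bounded_finite[OF assms(2)] by simp
  finally have fin: "emeasure lebesgue A < \<infinity>" .
  have "{x. x - s \<in> A} \<inter> {x. x - t \<in> A} = {}" if "s \<in> T" "t \<in> T" "s \<noteq> t" for s t
    using assms(5) that by blast
  moreover have "(\<Union>t\<in>T. {x. x - t \<in> A}) = UNIV"
    using assms(5) by blast
  ultimately have "tiles_with A T"
    using meas pos fin assms(4) unfolding tiles_with_def shift by auto
  then show ?thesis
    unfolding tiles_def by blast
qed

section \<open>A covering estimate and the exchange principle for tilings\<close>

lemma exists_outside_intervals: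
  fixes S :: "real set" and d g h :: real
  assumes "finite S" "0 < d" "card S * d < h - g"
  shows "\<exists>y. g \<le> y \<and> y < h \<and> (\<forall>s\<in>S. \<not> (s \<le> y \<and> y < s + d))"
proof (rule ccontr)
  assume *: "\<not> ?thesis"
  have gh: "g < h"
  proof -
    have "0 \<le> card S * d"
      using assms(2) by simp
    then show ?thesis
      using assms(3) by linarith
  qed
  have "{g..<h} \<subseteq> (\<Union>s\<in>S. {s..<s + d})"
  proof
    fix y
    assume "y \<in> {g..<h}"
    then have "\<exists>s\<in>S. s \<le> y \<and> y < s + d"
      using * by auto
    then show "y \<in> (\<Union>s\<in>S. {s..<s + d})"
      by auto
  qed
  then have "emeasure lborel {g..<h} \<le> emeasure lborel (\<Union>s\<in>S. {s..<s + d})"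
    using assms(1) by (intro emeasure_mono) auto
  also have "\<dots> \<le> (\<Sum>s\<in>S. emeasure lborel {s..<s + d})"
    using assms(1) by (intro emeasure_subadditive_finite) auto
  also have "\<dots> = ennreal (card S * d)"
    using assms(2) by (simp add: ennreal_mult ennreal_of_nat_eq_real_of_nat)
  finally have "h - g \<le> card S * d"
    using gh assms(2) by (simp add: ennreal_le_iff)
  then show False
    using assms(3) by simp
qed

text \<open>\<open>swap\<close> says that the \<open>T\<close>-translates of a piece
  \<open>D\<close> and of its copy displaced by \<open>v\<close> cover the same points. Hence what
  is lost by cutting out the pieces is exactly regained from the displaced copies, and disjointness
  of the pieces prevents double covering.\<close>

lemma tiling_swap:
  fixes T :: "('a::ab_group_add) set"
  assumes Q: "\<And>x. \<exists>!t. t \<in> T \<and> x - t \<in> Q"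
    and sub: "\<And>D v. (D, v) \<in> J \<Longrightarrow> D \<subseteq> Q"
    and disj: "\<And>D v D' v'. (D, v) \<in> J \<Longrightarrow> (D', v') \<in> J \<Longrightarrow> D \<inter> D' \<noteq> {} \<Longrightarrow> D = D' \<and> v = v'"
    and swap: "\<And>D v x. (D, v) \<in> J \<Longrightarrow> (\<exists>t\<in>T. x - t \<in> D) \<longleftrightarrow> (\<exists>t\<in>T. x - t - v \<in> D)"
    and E: "E = (Q - \<Union>(fst ` J)) \<union> {x. \<exists>(D, v)\<in>J. x - v \<in> D}"
  shows "\<exists>!t. t \<in> T \<and> x - t \<in> E"
proof -
  obtain s where s: "s \<in> T" "x - s \<in> Q" and unique: "\<And>t. t \<in> T \<Longrightarrow> x - t \<in> Q \<Longrightarrow> t = s"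
    using Q[of x] by blast
  have moved: "x - s \<in> D" if "(D, v) \<in> J" "t \<in> T" "x - t - v \<in> D" for D v t
  proof -
    have "\<exists>t'\<in>T. x - t' \<in> D"
      using swap[OF that(1), of x] that by blast
    then show ?thesis
      using unique sub[OF that(1)] by blast
  qed
  show ?thesis
  proof (cases "\<exists>(D, v)\<in>J. x - s \<in> D")
    case False
    then have "x - s \<in> E"
      using s unfolding E by auto
    moreover have "t = s" if "t \<in> T" "x - t \<in> E" for t
      using that unique moved False unfolding E by blast
    ultimately show ?thesis
      using s by blast
  next
    case True
    then obtain D v where D: "(D, v) \<in> J" "x - s \<in> D"
      by blast
    then obtain t where t: "t \<in> T" "x - t - v \<in> D"
      using swap[OF D(1), of x] s by blast
    have "x - t \<in> E"
      using D t unfolding E by blast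
    moreover have "t' = t" if t': "t' \<in> T" "x - t' \<in> E" for t'
    proof -
      have "\<not> (x - t' \<in> Q - \<Union>(fst ` J))"
        using t' unique D by force
      then obtain D' v' where D': "(D', v') \<in> J" "x - t' - v' \<in> D'"
        using t' unfolding E by blast
      then have "x - s \<in> D'"
        using moved t'(1) by blast
      then have "D' = D" "v' = v"
        using disj D D' by blast+
      \<comment> \<open>Both \<open>t\<close> and \<open>t'\<close> place the point
        \<open>x - v\<close> in a translate of \<open>Q\<close>, and that tile is unique.\<close>
      then have "x - v - t' \<in> Q" "x - v - t \<in> Q"
        using sub[OF D(1)] D' t by (auto simp: algebra_simps)
      then show ?thesis
        using Q[of "x - v"] t t' by blast
    qed
    ultimately show ?thesis
      using t by blast
  qed
qed

subsection \<open>The near-cube and its column tiling\<close>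

text \<open>The last bound on \<open>d\<close> is for two overlapping cubes: together they carry at
  most \<open>2 * (CARD('n) + 4)\<close> dents, which must not fill an overlap of width
  \<open>1/8\<close>.\<close>

locale near_cube =
  fixes a b c :: "'n::finite" and d :: real
  assumes distinct: "a \<noteq> b" "a \<noteq> c" "b \<noteq> c"
    and d: "0 < d" "d < 1/100" "16 * (real CARD('n) + 4) * d < 1"
begin

lemmas distinct' = distinct distinct[symmetric]

definition vec4 :: "real \<Rightarrow> real \<Rightarrow> real \<Rightarrow> real \<Rightarrow> real^'n" where
  "vec4 r s t u = (\<chi> k. if k = a then r else if k = b then s else if k = c then t else u)"

lemma vec4_nth [simp]:
  "vec4 r s t u $ a = r" "vec4 r s t u $ b = s" "vec4 r s t u $ c = t"
  "k \<noteq> a \<Longrightarrow> k \<noteq> b \<Longrightarrow> k \<noteq> c \<Longrightarrow> vec4 r s t u $ k = u"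
  using distinct by (auto simp: vec4_def)

lemma hbox_nth: "x \<in> hbox h p \<Longrightarrow> p $ k \<le> x $ k \<and> x $ k < p $ k + h"
  by (simp add: hbox_def)

lemma vec4_add: "vec4 r s t u + vec4 r' s' t' u' = vec4 (r + r') (s + s') (t + t') (u + u')"
  by (simp add: vec4_def vec_eq_iff)

lemma all_coords: "(\<forall>k. P k) \<longleftrightarrow> P a \<and> P b \<and> P c \<and> (\<forall>k. k \<noteq> a \<longrightarrow> k \<noteq> b \<longrightarrow> k \<noteq> c \<longrightarrow> P k)"
  by metis

lemma mem_hbox_vec4:
  "x \<in> hbox d (vec4 r s t u) \<longleftrightarrow>
    r \<le> x $ a \<and> x $ a < r + d \<and> s \<le> x $ b \<and> x $ b < s + d \<and> t \<le> x $ c \<and> x $ c < t + d \<and>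
    (\<forall>k. k \<noteq> a \<longrightarrow> k \<noteq> b \<longrightarrow> k \<noteq> c \<longrightarrow> u \<le> x $ k \<and> x $ k < u + d)"
  unfolding hbox_def mem_Collect_eq by (subst all_coords) auto

text \<open>The pieces are boxes of side \<open>d\<close> cut out of the unit cube at the dents and moved to the bumps.
  Piece \<open>C k\<close> sits in the middle of the face \<open>x $ k = 0\<close>, the pieces \<open>F1\<close> and \<open>F2\<close> on the face
  \<open>x $ b = 0\<close>, and \<open>B1\<close> and \<open>B2\<close> along two of the edges in direction \<open>a\<close>. The offsets in direction
  \<open>a\<close> only need to be generic enough for misplaced bumps to collide with the cube.\<close>

definition dentC :: "'n \<Rightarrow> real^'n" where "dentC k = (\<chi> i. if i = k then 0 else 1/2)"
definition bumpC :: "'n \<Rightarrow> real^'n" where "bumpC k = (\<chi> i. if i = k then 1 else 1/2)"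

abbreviation "K \<equiv> - {b, c}"
abbreviation "dentB1 \<equiv> vec4 (1/4) 0 0 (1/2)"
abbreviation "dentB2 \<equiv> vec4 (3/8) 0 (1 - d) (1/2)"
abbreviation "dentF1 \<equiv> vec4 (1/4) 0 (1/2) (1/2)"
abbreviation "dentF2 \<equiv> vec4 (3/4) 0 (1/2) (1/2)"
abbreviation "shift1 \<equiv> vec4 (1/2) 1 1 0"
abbreviation "shift2 \<equiv> vec4 0 1 (- 1) 0"
abbreviation "shiftF \<equiv> vec4 0 1 0 0"
abbreviation "bumpB1 \<equiv> vec4 (3/4) 1 1 (1/2)"
abbreviation "bumpB2 \<equiv> vec4 (3/8) 1 (- d) (1/2)"
abbreviation "bumpF1 \<equiv> vec4 (1/4) 1 (1/2) (1/2)"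
abbreviation "bumpF2 \<equiv> vec4 (3/4) 1 (1/2) (1/2)"

definition dents :: "(real^'n) set" where
  "dents = dentC ` K \<union> {dentB1, dentB2, dentF1, dentF2}"

text \<open>The two \<open>F\<close> boxes share one entry because \<open>shiftF\<close> is not a
  period of the column tiling: it may change the column height by a half, which interchanges the two
  boxes modulo 1. The other shifts are periods.\<close>

definition swaps :: "((real^'n) set \<times> (real^'n)) set" where
  "swaps = (\<lambda>k. (hbox d (dentC k), axis k 1)) ` K \<union>
    {(hbox d dentB1, shift1), (hbox d dentB2, shift2), (hbox d dentF1 \<union> hbox d dentF2, shiftF)}"

definition E :: "(real^'n) set" where
  "E = (hbox 1 0 - \<Union>(fst ` swaps)) \<union> {x. \<exists>(D, v)\<in>swaps. x - v \<in> D}"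

lemma bumps:
  "dentC k + axis k 1 = bumpC k" "dentB1 + shift1 = bumpB1" "dentB2 + shift2 = bumpB2"
  "dentF1 + shiftF = bumpF1" "dentF2 + shiftF = bumpF2"
  by (auto simp: vec4_add dentC_def bumpC_def axis_def vec_eq_iff)

lemma mem_hbox_dentC:
  "x \<in> hbox d (dentC k) \<longleftrightarrow>
    0 \<le> x $ k \<and> x $ k < d \<and> (\<forall>i. i \<noteq> k \<longrightarrow> 1/2 \<le> x $ i \<and> x $ i < 1/2 + d)"
  by (auto simp: hbox_def dentC_def)

lemma mem_E_iff:
  "x \<in> E \<longleftrightarrow> (x \<in> hbox 1 0 \<and> (\<forall>p\<in>dents. x \<notin> hbox d p)) \<or> (\<exists>k\<in>K. x \<in> hbox d (bumpC k)) \<or>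
    x \<in> hbox d bumpB1 \<or> x \<in> hbox d bumpB2 \<or> x \<in> hbox d bumpF1 \<or> x \<in> hbox d bumpF2"
  unfolding E_def swaps_def dents_def
  by (simp add: image_image ball_Un bex_Un hbox_translate bumps) blast

lemma mem_E_cases [consumes 1, case_names cube C B1 B2 F1 F2]:
  assumes "x \<in> E"
  obtains "x \<in> hbox 1 0" | k where "k \<noteq> b" "k \<noteq> c" "x \<in> hbox d (bumpC k)" |
    "x \<in> hbox d bumpB1" | "x \<in> hbox d bumpB2" | "x \<in> hbox d bumpF1" | "x \<in> hbox d bumpF2"
  using assms unfolding mem_E_iff by auto

section \<open>Position of dents and bumps relative to the unit cube\<close>

lemma finite_dents: "finite dents"
  by (simp add: dents_def)

lemma card_dents: "card dents \<le> CARD('n) + 4"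
proof -
  have "card dents \<le> card (dentC ` K) + card {dentB1, dentB2, dentF1, dentF2}"
    unfolding dents_def by (rule card_Un_le)
  moreover have "card (dentC ` K) \<le> CARD('n)"
    by (meson card_image_le card_mono finite le_trans subset_UNIV)
  moreover have "card {dentB1, dentB2, dentF1, dentF2} \<le> 4"
    by (simp add: card_insert_if)
  ultimately show ?thesis
    by linarith
qed

lemma dent_bounds: "p \<in> dents \<Longrightarrow> 0 \<le> p $ k \<and> p $ k + d \<le> 1"
  using d unfolding dents_def by (auto simp: dentC_def vec4_def)

lemma dent_subset_cube: "p \<in> dents \<Longrightarrow> hbox d p \<subseteq> hbox 1 0"
  using dent_bounds[of p] hbox_nth[of _ d p] unfolding hbox_def[of 1 0]
  by (smt (verit) mem_Collect_eq subsetI zero_index)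

lemma E_bounds:
  assumes "x \<in> E"
  shows "- d \<le> x $ k \<and> x $ k < 1 + d"
proof -
  have *: ?thesis if "x \<in> hbox d q" "- d \<le> q $ k \<and> q $ k \<le> 1" for q
    using hbox_nth[OF that(1), of k] that(2) by linarith
  show ?thesis
    using assms
  proof (cases rule: mem_E_cases)
    case cube
    then show ?thesis
      using hbox_nth[OF cube, of k] d by simp
  next
    case (C i)
    show ?thesis
      by (rule *[OF C(3)]) (use d in \<open>simp add: bumpC_def\<close>)
  next
    case B1
    show ?thesis
      by (rule *[OF B1]) (use d in \<open>simp add: vec4_def\<close>)
  next
    case B2
    show ?thesis
      by (rule *[OF B2]) (use d in \<open>simp add: vec4_def\<close>)
  next
    case F1
    show ?thesis
      by (rule *[OF F1]) (use d in \<open>simp add: vec4_def\<close>)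
  next
    case F2
    show ?thesis
      by (rule *[OF F2]) (use d in \<open>simp add: vec4_def\<close>)
  qed
qed

text \<open>Serves to identify the bump that fills a dent on the face \<open>x $ k = 0\<close>:
  every other bump starts at \<open>3/4\<close> or lower in direction \<open>k\<close>, so it ends
  before 1.\<close>

lemma E_beyond_K:
  assumes "x \<in> E" "k \<noteq> b" "k \<noteq> c" "1 \<le> x $ k"
  shows "x \<in> hbox d (bumpC k)"
proof -
  have *: False if "x \<in> hbox d q" "q $ k \<le> 3/4" for q
    using hbox_nth[OF that(1), of k] that(2) assms(4) d by linarith
  have **: False if "x \<in> hbox d (vec4 r s t (1/2))" "r \<le> 3/4" for r s t
    using *[OF that(1)] that(2) assms(2,3) by (cases "k = a") auto
  show ?thesis
    using assms(1)
  proof (cases rule: mem_E_cases)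
    case cube
    then show ?thesis
      using hbox_nth[OF cube, of k] assms(4) by simp
  next
    case (C i)
    then show ?thesis
      using *[OF C(3)] by (cases "i = k") (auto simp: bumpC_def)
  qed (auto dest!: **)
qed

lemma E_beyond_b:
  assumes "x \<in> E" "1 \<le> x $ b"
  shows "x \<in> hbox d bumpB1 \<or> x \<in> hbox d bumpB2 \<or> x \<in> hbox d bumpF1 \<or> x \<in> hbox d bumpF2"
  using assms(1)
proof (cases rule: mem_E_cases)
  case cube
  then show ?thesis
    using hbox_nth[OF cube, of b] assms(2) by simp
next
  case (C i)
  then show ?thesis
    using hbox_nth[OF C(3), of b] assms(2) d by (simp add: bumpC_def)
qed auto

lemma E_beyond_c:
  assumes "x \<in> E" "1 \<le> x $ c"
  shows "x \<in> hbox d bumpB1"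
  using assms(1)
proof (cases rule: mem_E_cases)
  case cube
  then show ?thesis
    using hbox_nth[OF cube, of c] assms(2) by simp
next
  case (C i)
  then show ?thesis
    using hbox_nth[OF C(3), of c] assms(2) d by (simp add: bumpC_def)
qed (use assms(2) d in \<open>auto simp: mem_hbox_vec4\<close>)

lemma E_below_c:
  assumes "x \<in> E" "x $ c < 0"
  shows "x \<in> hbox d bumpB2"
  using assms(1)
proof (cases rule: mem_E_cases)
  case cube
  then show ?thesis
    using hbox_nth[OF cube, of c] assms(2) by simp
next
  case (C i)
  then show ?thesis
    using hbox_nth[OF C(3), of c] assms(2) d by (simp add: bumpC_def)
qed (use assms(2) d in \<open>auto simp: mem_hbox_vec4\<close>)

text \<open>Every bump starts at coordinate 1 in some direction (\<open>k\<close> for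
  \<open>bumpC k\<close>, otherwise \<open>b\<close>), so no bump refills a dent of its own
  tile.\<close>

lemma dent_notin_E:
  assumes "p \<in> dents" "x \<in> hbox d p"
  shows "x \<notin> E"
proof
  assume "x \<in> E"
  have cube: "x \<in> hbox 1 0"
    using dent_subset_cube assms by blast
  have *: False if "x \<in> hbox d q" "1 \<le> q $ k" for q k
    using hbox_nth[OF that(1), of k] that(2) hbox_nth[OF cube, of k] by simp
  show False
    using \<open>x \<in> E\<close> unfolding mem_E_iff
    using assms *[of bumpB1 b] *[of bumpB2 b] *[of bumpF1 b] *[of bumpF2 b]
      *[of "bumpC k" k for k]
    by (auto simp: bumpC_def)
qed

text \<open>The boxes at \<open>dentC k\<close> with \<open>k \<in> K\<close> have
  \<open>b\<close>-coordinates of at least \<open>1/2\<close>, so near the face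
  \<open>x $ b = 0\<close> only the four other dents can be hit.\<close>

lemma mem_E_cube:
  assumes "x \<in> hbox 1 0" "x $ b < 1/2"
    and "x \<notin> hbox d dentB1" "x \<notin> hbox d dentB2" "x \<notin> hbox d dentF1" "x \<notin> hbox d dentF2"
  shows "x \<in> E"
proof -
  have "x \<notin> hbox d (dentC k)" if "k \<in> K" for k
    using that assms(2) by (auto simp: mem_hbox_dentC intro!: exI[of _ b])
  then show ?thesis
    using assms unfolding mem_E_iff dents_def by blast
qed

text \<open>Every dent lies along the boundary: some coordinate starts at 0, or the
  \<open>c\<close>-coordinate at \<open>1 - d\<close>. After rescaling, this core contains the
  closed unit cube.\<close>

lemma core_subset_E:
  assumes "\<And>k. d \<le> x $ k \<and> x $ k < 1 - d"
  shows "x \<in> E"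
proof -
  have "x \<notin> hbox d p" if "p \<in> dents" for p
  proof
    assume p: "x \<in> hbox d p"
    have "(\<exists>k. p $ k = 0) \<or> p $ c = 1 - d"
      using that unfolding dents_def dentC_def by (auto intro: exI[of _ b])
    then show False
      using hbox_nth[OF p] assms by (smt (verit))
  qed
  moreover have "x \<in> hbox 1 0"
    using assms d unfolding hbox_def by (smt (verit) mem_Collect_eq zero_index)
  ultimately show ?thesis
    unfolding mem_E_iff by blast
qed

text \<open>Columns in direction \<open>a\<close>, where the column above \<open>(i, j)\<close> has height \<open>\<lfloor>(i + j) / 2\<rfloor> / 2\<close>
  modulo 1. Opposite corners differ by \<open>shift1\<close> or \<open>shift2\<close>, which are periods of \<open>T\<close>, and columns
  sharing a \<open>b\<close>-face differ in height by \<open>0\<close> or \<open>1/2\<close>.\<close>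

definition T :: "(real^'n) set" where
  "T = {t. (\<forall>k. k \<noteq> a \<longrightarrow> t $ k \<in> \<int>) \<and> t $ a - of_int \<lfloor>(t $ b + t $ c) / 2\<rfloor> / 2 \<in> \<int>}"

text \<open>Off direction \<open>a\<close> the coordinates are forced to be floors; those in
  directions \<open>b\<close> and \<open>c\<close> fix the column height \<open>g\<close>, and the
  floor of \<open>x $ a - g\<close> then fixes the last one.\<close>

lemma T_tiles_cube: "\<exists>!t. t \<in> T \<and> x - t \<in> hbox 1 0"
proof -
  define g :: real where "g = of_int \<lfloor>(of_int \<lfloor>x $ b\<rfloor> + of_int \<lfloor>x $ c\<rfloor> :: real) / 2\<rfloor> / 2"
  define s :: "real^'n" where
    "s = (\<chi> k. if k = a then g + of_int \<lfloor>x $ a - g\<rfloor> else of_int \<lfloor>x $ k\<rfloor>)"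
  have "s \<in> T"
    using distinct by (simp add: T_def s_def g_def)
  moreover have "x - s \<in> hbox 1 0"
    unfolding hbox_def s_def by (auto simp: algebra_simps) linarith+
  moreover have "t = s" if t: "t \<in> T" "x - t \<in> hbox 1 0" for t
  proof -
    have int: "u = of_int \<lfloor>v\<rfloor>" if "u \<in> \<int>" "0 \<le> v - u" "v - u < 1" for u v :: real
      using that by (auto elim!: Ints_cases simp: floor_unique)
    have bounds: "0 \<le> x $ k - t $ k" "x $ k - t $ k < 1" for k
      using hbox_nth[OF t(2), of k] by auto
    have other: "t $ k = of_int \<lfloor>x $ k\<rfloor>" if "k \<noteq> a" for k
      using t(1) that bounds[of k] by (intro int) (auto simp: T_def)
    have "t $ a - g \<in> \<int>"
      using t(1) other[of b] other[of c] distinct by (auto simp: T_def g_def)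
    then have "t $ a - g = of_int \<lfloor>x $ a - g\<rfloor>"
      using bounds[of a] by (intro int) auto
    then show ?thesis
      using other by (simp add: s_def vec_eq_iff)
  qed
  ultimately show ?thesis
    by blast
qed

text \<open>As \<open>v $ b + v $ c\<close> is even, half the sum changes by an integer, so its
  floor changes by exactly \<open>m\<close>.\<close>

lemma T_translate:
  assumes "t \<in> T" and "\<And>k. k \<noteq> a \<Longrightarrow> v $ k \<in> \<int>"
    and "v $ b + v $ c = 2 * of_int m" "v $ a - of_int m / 2 \<in> \<int>"
  shows "t + v \<in> T"
proof -
  have "(t $ b + v $ b + (t $ c + v $ c)) / 2 = (t $ b + t $ c) / 2 + of_int m"
    using assms(3) by (simp add: field_simps)
  then have "\<lfloor>(t $ b + v $ b + (t $ c + v $ c)) / 2\<rfloor> = \<lfloor>(t $ b + t $ c) / 2\<rfloor> + m"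
    by (simp only: floor_add_int)
  then have "(t + v) $ a - of_int \<lfloor>((t + v) $ b + (t + v) $ c) / 2\<rfloor> / 2
      = (t $ a - of_int \<lfloor>(t $ b + t $ c) / 2\<rfloor> / 2) + (v $ a - of_int m / 2)"
    by (simp add: field_simps)
  also have "\<dots> \<in> \<int>"
    using assms(1,4) unfolding T_def by (intro Ints_add) auto
  finally show ?thesis
    using assms(1,2) unfolding T_def by simp
qed

lemma T_diff:
  assumes "t \<in> T" and "\<And>k. k \<noteq> a \<Longrightarrow> v $ k \<in> \<int>"
    and "v $ b + v $ c = 2 * of_int m" "v $ a - of_int m / 2 \<in> \<int>"
  shows "t - v \<in> T"
proof -
  have "(- v) $ a - of_int (- m) / 2 = - (v $ a - of_int m / 2)"
    by simp
  also have "\<dots> \<in> \<int>"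
    using assms(4) Ints_minus by blast
  finally have "t + (- v) \<in> T"
    using assms(1-3) by (intro T_translate[of t "- v" "- m"]) (auto simp: algebra_simps)
  then show ?thesis
    by simp
qed

lemma swap_period:
  assumes "\<And>k. k \<noteq> a \<Longrightarrow> v $ k \<in> \<int>" "v $ b + v $ c = 2 * of_int m" "v $ a - of_int m / 2 \<in> \<int>"
  shows "(\<exists>t\<in>T. x - t \<in> D) \<longleftrightarrow> (\<exists>t\<in>T. x - t - v \<in> D)"
proof
  assume "\<exists>t\<in>T. x - t \<in> D"
  then obtain t where "t \<in> T" "x - t \<in> D"
    by blast
  then show "\<exists>t\<in>T. x - t - v \<in> D"
    using T_diff[OF _ assms] by (intro bexI[of _ "t - v"]) auto
next
  assume "\<exists>t\<in>T. x - t - v \<in> D"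
  then obtain t where "t \<in> T" "x - t - v \<in> D"
    by blast
  then show "\<exists>t\<in>T. x - t \<in> D"
    using T_translate[OF _ assms] by (intro bexI[of _ "t + v"]) (auto simp: algebra_simps)
qed

text \<open>The sum of the \<open>b\<close>- and \<open>c\<close>-coordinates changes by 1, so the
  floor of its half changes by at most 1 and the height by 0 or a half. Both signs of the half step
  occur, as heights count modulo 1.\<close>

lemma T_step_b:
  assumes "t \<in> T" "\<sigma> = 1 \<or> \<sigma> = - 1"
  shows "t + vec4 0 \<sigma> 0 0 \<in> T \<or> (\<forall>s\<in>{1/2, - 1/2}. t + vec4 s \<sigma> 0 0 \<in> T)"
proof -
  obtain z where z: "t $ b + t $ c = of_int z"
  proof -
    have "t $ b \<in> \<int>" "t $ c \<in> \<int>"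
      using assms(1) distinct unfolding T_def by auto
    then show thesis
      using that Ints_add Ints_cases by metis
  qed
  obtain \<rho> :: int where \<rho>: "\<sigma> = of_int \<rho>" "\<rho> = 1 \<or> \<rho> = - 1"
    using assms(2) that[of 1] that[of "- 1"] by auto
  define m where "m = z div 2"
  define m' where "m' = (z + \<rho>) div 2"
  have m: "\<lfloor>(t $ b + t $ c) / 2\<rfloor> = m"
    unfolding z m_def using floor_divide_of_int_eq[of z 2] by simp
  have m': "\<lfloor>((t + vec4 s \<sigma> 0 0) $ b + (t + vec4 s \<sigma> 0 0) $ c) / 2\<rfloor> = m'" for s
  proof -
    have "((t + vec4 s \<sigma> 0 0) $ b + (t + vec4 s \<sigma> 0 0) $ c) = of_int (z + \<rho>)"
      using z \<rho> by simp
    then show ?thesis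
      unfolding m'_def using floor_divide_of_int_eq[of "z + \<rho>" 2] by simp
  qed
  have step: "t + vec4 s \<sigma> 0 0 \<in> T" if "s - of_int (m' - m) / 2 \<in> \<int>" for s
  proof -
    have "(t + vec4 s \<sigma> 0 0) $ a - of_int m' / 2 = (t $ a - of_int m / 2) + (s - of_int (m' - m) / 2)"
      by (simp add: field_simps)
    also have "\<dots> \<in> \<int>"
      using assms(1) that m unfolding T_def by (intro Ints_add) auto
    finally have "(t + vec4 s \<sigma> 0 0) $ a - of_int m' / 2 \<in> \<int>" .
    moreover have "(t + vec4 s \<sigma> 0 0) $ k \<in> \<int>" if "k \<noteq> a" for k
      using that assms(1) \<rho> unfolding T_def by (simp add: vec4_def)
    ultimately show ?thesis
      using m' unfolding T_def by simp
  qed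
  have "m' - m = 0 \<or> m' - m = 1 \<or> m' - m = - 1"
    using \<rho>(2) unfolding m_def m'_def by presburger
  then show ?thesis
  proof (elim disjE)
    assume "m' - m = 0"
    then show ?thesis
      using step[of 0] by simp
  qed (use step[of "1/2"] step[of "- 1/2"] in simp_all)
qed

section \<open>Invariance of the column tiling under the displacement of pieces\<close>

abbreviation "dentF \<equiv> hbox d dentF1 \<union> hbox d dentF2"

lemma dentF_half_turn:
  assumes "y \<in> dentF"
  obtains s where "s \<in> {1/2, - 1/2}" "y + vec4 s 0 0 0 \<in> dentF"
  using assms
proof
  assume "y \<in> hbox d dentF1"
  then have "y + vec4 (1/2) 0 0 0 \<in> hbox d dentF2"
    by (simp add: mem_hbox_vec4)
  then show thesis
    using that by blast
next
  assume "y \<in> hbox d dentF2"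
  then have "y + vec4 (- 1/2) 0 0 0 \<in> hbox d dentF1"
    by (simp add: mem_hbox_vec4)
  then show thesis
    using that by blast
qed

text \<open>A half step in column height is absorbed by passing to the other box of
  \<open>dentF\<close>; the box containing \<open>y\<close> decides the sign.\<close>

lemma T_dentF_step:
  assumes "t \<in> T" "y \<in> dentF" "\<sigma> = 1 \<or> \<sigma> = - 1"
  obtains t' where "t' \<in> T" "y + t - t' + vec4 0 \<sigma> 0 0 \<in> dentF"
proof -
  consider "t + vec4 0 \<sigma> 0 0 \<in> T" | "\<forall>s\<in>{1/2, - 1/2}. t + vec4 s \<sigma> 0 0 \<in> T"
    using T_step_b assms by blast
  then show thesis
  proof cases
    case 1
    then show thesis
      using that[of "t + vec4 0 \<sigma> 0 0"] assms(2) by simp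
  next
    case 2
    obtain s where s: "s \<in> {1/2, - 1/2}" "y + vec4 s 0 0 0 \<in> dentF"
      using dentF_half_turn[OF assms(2)] by blast
    have "- s \<in> {1/2, - 1/2}"
      using s(1) by auto
    then have "t + vec4 (- s) \<sigma> 0 0 \<in> T"
      using 2 by blast
    moreover have "y + t - (t + vec4 (- s) \<sigma> 0 0) + vec4 0 \<sigma> 0 0 = y + vec4 s 0 0 0"
      by (simp add: vec_eq_iff vec4_def)
    ultimately show thesis
      using that s(2) by metis
  qed
qed

lemma swap_dentF: "(\<exists>t\<in>T. x - t \<in> dentF) \<longleftrightarrow> (\<exists>t\<in>T. x - t - shiftF \<in> dentF)"
proof
  assume "\<exists>t\<in>T. x - t \<in> dentF"
  then obtain t where t: "t \<in> T" "x - t \<in> dentF"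
    by blast
  obtain t' where "t' \<in> T" "x - t + t - t' + vec4 0 (- 1) 0 0 \<in> dentF"
    using T_dentF_step[OF t, of "- 1"] by blast
  moreover have "x - t + t - t' + vec4 0 (- 1) 0 0 = x - t' - shiftF"
    by (simp add: vec_eq_iff vec4_def)
  ultimately show "\<exists>t\<in>T. x - t - shiftF \<in> dentF"
    by metis
next
  assume "\<exists>t\<in>T. x - t - shiftF \<in> dentF"
  then obtain t where t: "t \<in> T" "x - t - shiftF \<in> dentF"
    by blast
  obtain t' where "t' \<in> T" "x - t - shiftF + t - t' + vec4 0 1 0 0 \<in> dentF"
    using T_dentF_step[OF t, of 1] by blast
  moreover have "x - t - shiftF + t - t' + vec4 0 1 0 0 = x - t'"
    by (simp add: vec_eq_iff vec4_def)
  ultimately show "\<exists>t\<in>T. x - t \<in> dentF"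
    by metis
qed

lemma swaps_subset_cube: "(D, v) \<in> swaps \<Longrightarrow> D \<subseteq> hbox 1 0"
  unfolding swaps_def by (auto dest: dent_subset_cube[THEN subsetD, rotated] simp: dents_def)

lemma swaps_cases [consumes 1, case_names C B1 B2 F]:
  assumes "(D, v) \<in> swaps"
  obtains k where "k \<in> K" "D = hbox d (dentC k)" "v = axis k 1" |
    "D = hbox d dentB1" "v = shift1" | "D = hbox d dentB2" "v = shift2" |
    "D = dentF" "v = shiftF"
  using assms unfolding swaps_def by blast

text \<open>Two coordinates separate pieces of different kinds: \<open>b\<close> is at least
  \<open>1/2\<close> on the \<open>C\<close> dents and small on the rest, where \<open>c\<close> is
  near 0, \<open>1/2\<close> and 1 for \<open>B1\<close>, \<open>F\<close> and
  \<open>B2\<close>.\<close>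

lemma swaps_disjoint:
  assumes "(D, v) \<in> swaps" "(D', v') \<in> swaps" "D \<inter> D' \<noteq> {}"
  shows "D = D' \<and> v = v'"
proof -
  obtain y where y: "y \<in> D" "y \<in> D'"
    using assms(3) by blast
  have inC: "1/2 \<le> y $ b" if "k \<in> K" "y \<in> hbox d (dentC k)" for k
    using that by (auto simp: mem_hbox_dentC)
  have CC: "k = k'" if "y \<in> hbox d (dentC k)" "y \<in> hbox d (dentC k')" for k k'
    using hbox_nth[OF that(1), of k] hbox_nth[OF that(2), of k] d
    by (auto simp: dentC_def split: if_splits)
  have inB1: "y $ b < 1/2 \<and> y $ c < 1/4" if "y \<in> hbox d dentB1"
    using that d by (auto simp: mem_hbox_vec4)
  have inB2: "y $ b < 1/2 \<and> 3/4 < y $ c" if "y \<in> hbox d dentB2"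
    using that d by (auto simp: mem_hbox_vec4)
  have inF: "y $ b < 1/2 \<and> 1/4 \<le> y $ c \<and> y $ c \<le> 3/4" if "y \<in> dentF"
    using that d by (auto simp: mem_hbox_vec4)
  have C_other: "y \<notin> hbox d dentB1 \<and> y \<notin> hbox d dentB2 \<and> y \<notin> dentF"
    if "k \<in> K" "y \<in> hbox d (dentC k)" for k
    using inC[OF that] inB1 inB2 inF by linarith
  have B1_other: "y \<notin> hbox d dentB2 \<and> y \<notin> dentF" if "y \<in> hbox d dentB1"
    using inB1[OF that] inB2 inF by linarith
  have B2_other: "y \<notin> dentF" if "y \<in> hbox d dentB2"
    using inB2[OF that] inF by linarith
  show ?thesis
    using assms(1)
  proof (cases rule: swaps_cases)
    case (C k)
    have "y \<in> hbox d (dentC k)"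
      using C y by simp
    with assms(2) show ?thesis
      by (cases rule: swaps_cases) (use C y CC C_other[of k] in \<open>metis\<close>)+
  next
    case B1
    with assms(2) show ?thesis
      by (cases rule: swaps_cases) (use y C_other B1_other in \<open>metis\<close>)+
  next
    case B2
    with assms(2) show ?thesis
      by (cases rule: swaps_cases) (use y C_other B1_other B2_other in \<open>metis\<close>)+
  next
    case F
    with assms(2) show ?thesis
      by (cases rule: swaps_cases) (use y C_other B1_other B2_other in \<open>metis\<close>)+
  qed
qed

lemma swaps_swap:
  assumes "(D, v) \<in> swaps"
  shows "(\<exists>t\<in>T. x - t \<in> D) \<longleftrightarrow> (\<exists>t\<in>T. x - t - v \<in> D)"
proof -
  have axis: "(\<exists>t\<in>T. x - t \<in> D) \<longleftrightarrow> (\<exists>t\<in>T. x - t - v \<in> D)" if "v = axis k 1" "k \<in> K" for k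
    using that by (intro swap_period[of _ 0]) (auto simp: axis_def)
  have s1: "(\<exists>t\<in>T. x - t \<in> D) \<longleftrightarrow> (\<exists>t\<in>T. x - t - v \<in> D)" if "v = shift1"
    using that by (intro swap_period[of _ 1]) (auto simp: vec4_def distinct')
  have s2: "(\<exists>t\<in>T. x - t \<in> D) \<longleftrightarrow> (\<exists>t\<in>T. x - t - v \<in> D)" if "v = shift2"
    using that by (intro swap_period[of _ 0]) (auto simp: vec4_def distinct')
  show ?thesis
    using assms axis s1 s2 swap_dentF[of x] unfolding swaps_def by blast
qed

lemma E_tiling: "\<exists>!t. t \<in> T \<and> x - t \<in> E"
  using T_tiles_cube swaps_subset_cube swaps_disjoint swaps_swap E_def by (rule tiling_swap)

text \<open>Some coordinate of two distinct points differs by a nonzero integer; within one column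
  this is the \<open>a\<close>-coordinate, because the floor terms cancel.\<close>

lemma discrete_T: "discrete_set T"
  unfolding discrete_set_def
proof (intro ballI exI conjI impI)
  fix s t
  assume st: "s \<in> T" "t \<in> T" "t \<noteq> s"
  have "\<exists>k. s $ k - t $ k \<in> \<int> \<and> s $ k \<noteq> t $ k"
  proof (cases "\<exists>k. k \<noteq> a \<and> s $ k \<noteq> t $ k")
    case True
    then show ?thesis
      using st Ints_diff unfolding T_def by blast
  next
    case False
    then have "s $ a \<noteq> t $ a"
      using st(3) by (metis vec_eq_iff)
    moreover have "s $ b = t $ b" "s $ c = t $ c"
      using False distinct by auto
    then have "(s $ a - of_int \<lfloor>(s $ b + s $ c) / 2\<rfloor> / 2) - (t $ a - of_int \<lfloor>(t $ b + t $ c) / 2\<rfloor> / 2)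
        = s $ a - t $ a"
      by simp
    then have "s $ a - t $ a \<in> \<int>"
      using st(1,2) Ints_diff unfolding T_def by (metis (mono_tags, lifting) mem_Collect_eq)
    ultimately show ?thesis
      by blast
  qed
  then obtain k where "s $ k - t $ k \<in> \<int>" "s $ k \<noteq> t $ k"
    by blast
  then have "1 \<le> \<bar>s $ k - t $ k\<bar>"
    using Ints_nonzero_abs_ge1 by force
  then show "1 \<le> dist s t"
    using component_le_norm_cart[of "s - t" k] by (simp add: dist_norm)
qed simp

section \<open>Measurability and right-clopenness of \<open>E\<close>\<close>

lemma E_Un_boxes:
  "E = (hbox 1 0 - (\<Union>p\<in>dents. hbox d p)) \<union>
    ((\<Union>k\<in>K. hbox d (bumpC k)) \<union> hbox d bumpB1 \<union> hbox d bumpB2 \<union> hbox d bumpF1 \<union> hbox d bumpF2)"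
  using mem_E_iff by blast

lemma E_borel: "E \<in> sets borel"
  unfolding E_Un_boxes using finite_dents hbox_borel
  by (intro sets.Un sets.Diff sets.finite_UN) auto

lemma right_clopen_E: "right_clopen E"
  unfolding E_Un_boxes Diff_eq using finite_dents
  by (intro right_clopen_Un right_clopen_Int right_clopen_Compl right_clopen_UN right_clopen_hbox) auto

end

subsection \<open>Tilings by subgroups\<close>

locale near_cube_subgroup_tiling = near_cube a b c d
  for a b c :: "'n::finite" and d :: real +
  fixes L :: "(real^'n) set"
  assumes zero: "0 \<in> L" and diff: "s \<in> L \<Longrightarrow> t \<in> L \<Longrightarrow> s - t \<in> L"
    and tiling: "\<exists>!l. l \<in> L \<and> x - l \<in> E"
begin

lemma add: "s \<in> L \<Longrightarrow> t \<in> L \<Longrightarrow> s + t \<in> L"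
  using diff[of s "0 - t"] diff[OF zero, of t] by simp

lemma overlap_imp_zero: "l \<in> L \<Longrightarrow> q \<in> E \<Longrightarrow> q - l \<in> E \<Longrightarrow> l = 0"
  using tiling[of q] zero by (metis diff_zero)

text \<open>The pieces are too few and too small to cover the overlap of two cubes that is not thin in
  direction \<open>m\<close>.\<close>

lemma small_imp_zero:
  assumes "l \<in> L" "\<forall>k. \<bar>l $ k\<bar> < 1" "\<bar>l $ m\<bar> \<le> 7/8"
  shows "l = 0"
proof -
  let ?S = "(\<lambda>p. p $ m) ` dents \<union> (\<lambda>p. p $ m + l $ m) ` dents"
  have "card ?S \<le> card dents + card dents"
    by (intro order_trans[OF card_Un_le] add_mono card_image_le finite_dents)
  also have "\<dots> \<le> 2 * (CARD('n) + 4)"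
    unfolding mult_2 by (intro add_mono card_dents)
  finally have "card ?S \<le> 2 * (CARD('n) + 4)" .
  then have "card ?S * d \<le> real (2 * (CARD('n) + 4)) * d"
    using d(1) by (intro mult_right_mono) (simp_all only: of_nat_le_iff less_imp_le)
  also have "\<dots> < 1/8"
    using d(3) by (simp add: algebra_simps)
  \<comment> \<open>The two cubes overlap in width \<open>1 - \<bar>l $ m\<bar>\<close> in direction
    \<open>m\<close>.\<close>
  also have "1/8 \<le> min 1 (1 + l $ m) - max 0 (l $ m)"
    using assms(3) by (auto simp: min_def max_def abs_le_iff)
  finally obtain y where y: "max 0 (l $ m) \<le> y" "y < min 1 (1 + l $ m)"
    "\<And>s. s \<in> ?S \<Longrightarrow> \<not> (s \<le> y \<and> y < s + d)"
    using exists_outside_intervals[of ?S d "min 1 (1 + l $ m)" "max 0 (l $ m)"] finite_dents d(1)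
    by blast
  \<comment> \<open>The single coordinate \<open>y\<close> keeps the point out of all dents of both
    cubes; the other coordinates are those of the lower corner of the overlap.\<close>
  define x where "x = (\<chi> k. if k = m then y else max 0 (l $ k))"
  have "max 0 (l $ k) < 1 \<and> max 0 (l $ k) - l $ k < 1" for k
    using assms(2)[rule_format, of k] by linarith
  then have "x \<in> hbox 1 0" "x - l \<in> hbox 1 0"
    using y(1,2) unfolding hbox_def x_def by auto
  moreover have "x \<notin> hbox d p" "x - l \<notin> hbox d p" if "p \<in> dents" for p
    using hbox_nth[of x d p m] hbox_nth[of "x - l" d p m] y(3)[of "p $ m"] y(3)[of "p $ m + l $ m"] that
    unfolding x_def by auto
  ultimately have "x \<in> E" "x - l \<in> E"
    unfolding mem_E_iff by auto
  then show ?thesis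
    using overlap_imp_zero assms(1) by blast
qed

lemma small_imp_zero4:
  assumes "l \<in> L" "\<bar>l $ a\<bar> < 7/8" "\<bar>l $ b\<bar> < 1" "\<bar>l $ c\<bar> < 1"
    "\<And>k. k \<noteq> a \<Longrightarrow> k \<noteq> b \<Longrightarrow> k \<noteq> c \<Longrightarrow> \<bar>l $ k\<bar> < 1"
  shows "l = 0"
proof -
  have "\<forall>k. \<bar>l $ k\<bar> < 1"
    using assms by (subst all_coords) auto
  then show ?thesis
    using small_imp_zero[of l a] assms by simp
qed

section \<open>Periods forced by filling the dents\<close>

text \<open>Two translations bringing the bump onto points of the dent differ by a short vector,
  hence agree. A single translate of a half-open box covers another one of equal side only in exact
  position.\<close>

lemma filled_imp_shift_mem:
  assumes "\<And>l x. l \<in> L \<Longrightarrow> x \<in> hbox d p \<Longrightarrow> x - l \<in> E \<Longrightarrow> x - l \<in> hbox d (p + v)"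
  shows "v \<in> L"
proof -
  have "p \<in> hbox d p"
    using d by (simp add: hbox_def)
  then obtain l where l: "l \<in> L" "p - l \<in> hbox d (p + v)"
    using assms tiling by blast
  have same: "x - l \<in> hbox d (p + v)" if x: "x \<in> hbox d p" for x
  proof -
    obtain l' where l': "l' \<in> L" "x - l' \<in> hbox d (p + v)"
      using assms x tiling by blast
    have half: "\<bar>(l - l') $ k\<bar> < 1/2" for k
      using hbox_nth[OF l(2), of k] hbox_nth[OF l'(2), of k] hbox_nth[OF x, of k] d
      by (simp only: vector_minus_component vector_add_component abs_less_iff) linarith
    then have "\<bar>(l - l') $ k\<bar> < 1 \<and> \<bar>(l - l') $ k\<bar> \<le> 7/8" for k
      using half[of k] by linarith
    then have "l - l' = 0"
      using small_imp_zero[OF diff[OF l(1) l'(1)]] by blast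
    then show ?thesis
      using l' by simp
  qed
  have "l $ k = - v $ k" for k
  proof (rule ccontr)
    assume "l $ k \<noteq> - v $ k"
    define w where "w = - v $ k - l $ k"
    have w: "0 < w" "w < d"
      using hbox_nth[OF l(2), of k] \<open>l $ k \<noteq> - v $ k\<close> unfolding w_def by auto
    \<comment> \<open>If \<open>l\<close> misses \<open>- v\<close> by \<open>w\<close> in direction
      \<open>k\<close>, this point is carried exactly to the excluded right end of the bump.\<close>
    have "p + axis k (d - w) \<in> hbox d p"
      using w d by (auto simp: hbox_def axis_def)
    from hbox_nth[OF same[OF this], of k] show False
      unfolding w_def by (simp add: axis_def)
  qed
  then have "0 - l = v"
    by (simp add: vec_eq_iff)
  then show ?thesis
    using diff[OF zero l(1)] by simp
qed

text \<open>The dent lies in the middle of its face, so the covering translation is short in every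
  direction but \<open>k\<close>. Being nonzero, it moves by at least 1 along \<open>k\<close>, and
  only \<open>bumpC k\<close> sticks out beyond the opposite face.\<close>

lemma axis_mem:
  assumes "k \<in> K"
  shows "axis k 1 \<in> L"
proof (rule filled_imp_shift_mem[of "dentC k"], unfold bumps)
  fix l x
  assume l: "l \<in> L" "x \<in> hbox d (dentC k)" "x - l \<in> E"
  have x: "0 \<le> x $ k" "x $ k < d" "\<And>i. i \<noteq> k \<Longrightarrow> 1/2 \<le> x $ i \<and> x $ i < 1/2 + d"
    using l(2) by (auto simp: mem_hbox_dentC)
  have y: "- d \<le> x $ i - l $ i" "x $ i - l $ i < 1 + d" for i
    using E_bounds[OF l(3), of i] by auto
  have other: "\<bar>l $ i\<bar> < 7/8" if "i \<noteq> k" for i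
    using x(3)[OF that] y[of i] d unfolding abs_less_iff by linarith
  have "l \<noteq> 0"
    using dent_notin_E[of "dentC k" x] l assms by (auto simp: dents_def)
  moreover have "l = 0" if "\<bar>l $ k\<bar> < 1"
  proof (rule small_imp_zero[OF l(1)])
    show "\<forall>i. \<bar>l $ i\<bar> < 1"
      using that other by force
    show "\<bar>l $ b\<bar> \<le> 7/8"
      using other[of b] assms by force
  qed
  ultimately have "\<not> \<bar>l $ k\<bar> < 1"
    by blast
  then have "1 \<le> (x - l) $ k"
    using x(1,2) y[of k] d by auto
  then show "x - l \<in> hbox d (bumpC k)"
    using E_beyond_K[OF l(3)] assms by simp
qed

text \<open>The partner bump stands half a step away along \<open>a\<close>, modulo the period
  \<open>axis a 1\<close>, and would collide with the tile at
  \<open>x + vec4 (1/2) 0 0 0\<close>.\<close>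

lemma bumpF_not_filling:
  assumes "l \<in> L" "l $ b \<noteq> 0" and q: "x + vec4 (1/2) 0 0 0 \<in> E"
  shows "x - l \<notin> hbox d bumpF1" "x - l \<notin> hbox d bumpF2"
proof -
  show "x - l \<notin> hbox d bumpF1"
  proof
    assume "x - l \<in> hbox d bumpF1"
    then have "x + vec4 (1/2) 0 0 0 - l \<in> hbox d bumpF2"
      by (auto simp: mem_hbox_vec4)
    then have "x + vec4 (1/2) 0 0 0 - l \<in> E"
      unfolding mem_E_iff by blast
    then show False
      using q overlap_imp_zero assms(1,2) by force
  qed
  show "x - l \<notin> hbox d bumpF2"
  proof
    assume "x - l \<in> hbox d bumpF2"
    then have "x + vec4 (1/2) 0 0 0 - (l + axis a 1) \<in> hbox d bumpF1"
      by (auto simp: mem_hbox_vec4 axis_def distinct')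
    then have "x + vec4 (1/2) 0 0 0 - (l + axis a 1) \<in> E"
      unfolding mem_E_iff by blast
    then have "l + axis a 1 = 0"
      using q overlap_imp_zero add[OF assms(1) axis_mem[of a]] distinct by blast
    then have "(l + axis a 1) $ b = 0"
      by simp
    then show False
      using assms(2) distinct by (simp add: axis_def)
  qed
qed

text \<open>The dent lies on an edge, so the filling tile is displaced by at least 1 along
  \<open>b\<close> or \<open>c\<close>. Beyond the \<open>c\<close>-face only \<open>bumpB1\<close>
  sticks out; beyond the \<open>b\<close>-face each wrong bump brings along a second bump that hits
  the tile.\<close>

lemma shift1_mem: "shift1 \<in> L"
proof (rule filled_imp_shift_mem[of dentB1], unfold bumps)
  fix l x
  assume l: "l \<in> L" "x \<in> hbox d dentB1" "x - l \<in> E"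
  have x: "1/4 \<le> x $ a" "x $ a < 1/4 + d" "0 \<le> x $ b" "x $ b < d" "0 \<le> x $ c" "x $ c < d"
    and x': "\<And>k. k \<noteq> a \<Longrightarrow> k \<noteq> b \<Longrightarrow> k \<noteq> c \<Longrightarrow> 1/2 \<le> x $ k \<and> x $ k < 1/2 + d"
    using l(2) by (auto simp: mem_hbox_vec4)
  have y: "- d \<le> x $ i - l $ i" "x $ i - l $ i < 1 + d" for i
    using E_bounds[OF l(3), of i] by auto
  have other: "\<bar>l $ k\<bar> < 1" if "k \<noteq> a" "k \<noteq> b" "k \<noteq> c" for k
    using x'[OF that] y[of k] d unfolding abs_less_iff by linarith
  have la: "\<bar>l $ a\<bar> < 7/8"
    using x y[of a] d unfolding abs_less_iff by linarith
  have "l \<noteq> 0"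
    using dent_notin_E[of dentB1 x] l by (auto simp: dents_def)
  then have "\<not> \<bar>l $ b\<bar> < 1 \<or> \<not> \<bar>l $ c\<bar> < 1"
    using small_imp_zero4[OF l(1) la] other by blast
  then consider "1 \<le> (x - l) $ b" | "1 \<le> (x - l) $ c"
    using x y[of b] y[of c] d by fastforce
  then show "x - l \<in> hbox d bumpB1"
  proof cases
    case b: 1
    show ?thesis
      using E_beyond_b[OF l(3) b]
    proof (elim disjE)
      assume "x - l \<in> hbox d bumpB2"
      \<comment> \<open>This is the displacement from \<open>bumpB2\<close> to
        \<open>bumpF1\<close>; it leads to an \<open>a\<close>-coordinate near \<open>1/8\<close>,
        clear of \<open>dentF1\<close>.\<close>
      then have "x + vec4 (- 1/8) 0 (1/2 + d) 0 - l \<in> hbox d bumpF1"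
        by (auto simp: mem_hbox_vec4)
      then have "x + vec4 (- 1/8) 0 (1/2 + d) 0 - l \<in> E"
        unfolding mem_E_iff by blast
      moreover have "x + vec4 (- 1/8) 0 (1/2 + d) 0 \<in> hbox 1 0"
        unfolding hbox_def mem_Collect_eq using x x' d by (subst all_coords) force
      then have "x + vec4 (- 1/8) 0 (1/2 + d) 0 \<in> E"
        using x d by (intro mem_E_cube) (auto simp: mem_hbox_vec4)
      ultimately show ?thesis
        using overlap_imp_zero l(1) \<open>l \<noteq> 0\<close> by blast
    next
      have "x + vec4 (1/2) 0 0 0 \<in> hbox 1 0"
        unfolding hbox_def mem_Collect_eq using x x' d by (subst all_coords) force
      then have q: "x + vec4 (1/2) 0 0 0 \<in> E"
        using x d by (intro mem_E_cube) (auto simp: mem_hbox_vec4)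
      have "l $ b \<noteq> 0"
        using b x d by auto
      then show "x - l \<in> hbox d bumpF1 \<Longrightarrow> ?thesis" "x - l \<in> hbox d bumpF2 \<Longrightarrow> ?thesis"
        using bumpF_not_filling[OF l(1) _ q] by blast+
    qed
  qed (rule E_beyond_c[OF l(3)])
qed

text \<open>As for \<open>shift1\<close>, but on the edge where \<open>c\<close> is near 1, so that
  a tile displaced along \<open>c\<close> must reach in with its part below the face
  \<open>x $ c = 0\<close>.\<close>

lemma shift2_mem: "shift2 \<in> L"
proof (rule filled_imp_shift_mem[of dentB2], unfold bumps)
  fix l x
  assume l: "l \<in> L" "x \<in> hbox d dentB2" "x - l \<in> E"
  have x: "3/8 \<le> x $ a" "x $ a < 3/8 + d" "0 \<le> x $ b" "x $ b < d" "1 - d \<le> x $ c" "x $ c < 1"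
    and x': "\<And>k. k \<noteq> a \<Longrightarrow> k \<noteq> b \<Longrightarrow> k \<noteq> c \<Longrightarrow> 1/2 \<le> x $ k \<and> x $ k < 1/2 + d"
    using l(2) by (auto simp: mem_hbox_vec4)
  have y: "- d \<le> x $ i - l $ i" "x $ i - l $ i < 1 + d" for i
    using E_bounds[OF l(3), of i] by auto
  have other: "\<bar>l $ k\<bar> < 1" if "k \<noteq> a" "k \<noteq> b" "k \<noteq> c" for k
    using x'[OF that] y[of k] d unfolding abs_less_iff by linarith
  have la: "\<bar>l $ a\<bar> < 7/8"
    using x y[of a] d unfolding abs_less_iff by linarith
  have "l \<noteq> 0"
    using dent_notin_E[of dentB2 x] l by (auto simp: dents_def)
  then have "\<not> \<bar>l $ b\<bar> < 1 \<or> \<not> \<bar>l $ c\<bar> < 1"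
    using small_imp_zero4[OF l(1) la] other by blast
  then consider "1 \<le> (x - l) $ b" | "(x - l) $ c < 0"
    using x y[of b] y[of c] d by fastforce
  then show "x - l \<in> hbox d bumpB2"
  proof cases
    case b: 1
    show ?thesis
      using E_beyond_b[OF l(3) b]
    proof (elim disjE)
      assume "x - l \<in> hbox d bumpB1"
      \<comment> \<open>This is the displacement from \<open>bumpB1\<close> to
        \<open>bumpF2\<close>; the \<open>a\<close>-coordinate stays near \<open>3/8\<close>,
        between \<open>dentF1\<close> and \<open>dentF2\<close>.\<close>
      then have "x + vec4 0 0 (- 1/2) 0 - l \<in> hbox d bumpF2"
        by (auto simp: mem_hbox_vec4)
      then have "x + vec4 0 0 (- 1/2) 0 - l \<in> E"
        unfolding mem_E_iff by blast
      moreover have "x + vec4 0 0 (- 1/2) 0 \<in> hbox 1 0"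
        unfolding hbox_def mem_Collect_eq using x x' d by (subst all_coords) force
      then have "x + vec4 0 0 (- 1/2) 0 \<in> E"
        using x d by (intro mem_E_cube) (auto simp: mem_hbox_vec4)
      ultimately show ?thesis
        using overlap_imp_zero l(1) \<open>l \<noteq> 0\<close> by blast
    next
      have "x + vec4 (1/2) 0 0 0 \<in> hbox 1 0"
        unfolding hbox_def mem_Collect_eq using x x' d by (subst all_coords) force
      then have q: "x + vec4 (1/2) 0 0 0 \<in> E"
        using x d by (intro mem_E_cube) (auto simp: mem_hbox_vec4)
      have "l $ b \<noteq> 0"
        using b x d by auto
      then show "x - l \<in> hbox d bumpF1 \<Longrightarrow> ?thesis" "x - l \<in> hbox d bumpF2 \<Longrightarrow> ?thesis"
        using bumpF_not_filling[OF l(1) _ q] by blast+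
    qed
  qed (rule E_below_c[OF l(3)])
qed

text \<open>A neighbour \<open>l\<close> across the face \<open>x $ b = 0\<close> would satisfy
  \<open>2 * l = - shift1 - shift2\<close> up to small errors and multiples of \<open>axis a 1\<close>, so it would be
  offset by \<open>1/4\<close> or \<open>3/4\<close> in direction \<open>a\<close>, whereas the pieces \<open>F1\<close> and \<open>F2\<close> only fit at
  offsets \<open>0\<close> and \<open>1/2\<close>.\<close>

lemma inconsistent: False
proof -
  obtain l where l: "l \<in> L" "dentF1 - l \<in> E"
    using tiling by blast
  have y: "- d \<le> dentF1 $ i - l $ i" "dentF1 $ i - l $ i < 1 + d" for i
    using E_bounds[OF l(2), of i] by auto
  have "dentF1 \<in> hbox d dentF1"
    using d by (simp add: hbox_def)
  then have "l \<noteq> 0"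
    using dent_notin_E[of dentF1 dentF1] l by (auto simp: dents_def)
  have other: "\<bar>l $ k\<bar> < 1" if "k \<noteq> a" "k \<noteq> b" "k \<noteq> c" for k
    using y[of k] that d unfolding abs_less_iff by simp
  have la: "\<bar>l $ a\<bar> < 7/8" and lc: "\<bar>l $ c\<bar> < 1"
    using y[of a] y[of c] d unfolding abs_less_iff by simp_all
  have "\<not> \<bar>l $ b\<bar> < 1"
    using small_imp_zero4[OF l(1) la _ lc other] \<open>l \<noteq> 0\<close> by blast
  then have "1 \<le> (dentF1 - l) $ b"
    using y[of b] d by auto
  from E_beyond_b[OF l(2) this] show False
  proof (elim disjE)
    assume h: "dentF1 - l \<in> hbox d bumpB1"
    \<comment> \<open>The sum is short, hence zero, yet its \<open>c\<close>-coordinate is about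
      \<open>1/2\<close>; with \<open>shift2\<close> it is about \<open>- 1/2\<close>.\<close>
    have "l + shift1 = 0"
    proof (rule small_imp_zero4[OF add[OF l(1) shift1_mem]])
      show "\<bar>(l + shift1) $ k\<bar> < 1" if "k \<noteq> a" "k \<noteq> b" "k \<noteq> c" for k
        using that other by simp
    qed (use h d in \<open>auto simp: mem_hbox_vec4 abs_less_iff\<close>)
    then have "(l + shift1) $ c = 0"
      by simp
    then show False
      using h d by (simp add: mem_hbox_vec4)
  next
    assume h: "dentF1 - l \<in> hbox d bumpB2"
    have "l + shift2 = 0"
    proof (rule small_imp_zero4[OF add[OF l(1) shift2_mem]])
      show "\<bar>(l + shift2) $ k\<bar> < 1" if "k \<noteq> a" "k \<noteq> b" "k \<noteq> c" for k
        using that other by simp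
    qed (use h d in \<open>auto simp: mem_hbox_vec4 abs_less_iff\<close>)
    then have "(l + shift2) $ c = 0"
      by simp
    then show False
      using h d by (simp add: mem_hbox_vec4)
  next
    assume h: "dentF1 - l \<in> hbox d bumpF1"
    have "l + l + (shift1 + shift2) = 0"
    proof (rule small_imp_zero4[OF add[OF add[OF l(1) l(1)] add[OF shift1_mem shift2_mem]]])
      show "\<bar>(l + l + (shift1 + shift2)) $ k\<bar> < 1" if "k \<noteq> a" "k \<noteq> b" "k \<noteq> c" for k
        using that hbox_nth[OF h, of k] d by (auto simp: abs_less_iff)
    qed (use h d in \<open>auto simp: mem_hbox_vec4 abs_less_iff\<close>)
    then have "(l + l + (shift1 + shift2)) $ a = 0"
      by simp
    then show False
      using h d by (simp add: mem_hbox_vec4)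
  next
    assume h: "dentF1 - l \<in> hbox d bumpF2"
    have "l + l + (shift1 + shift2) = 0"
    proof (rule small_imp_zero4[OF add[OF add[OF l(1) l(1)] add[OF shift1_mem shift2_mem]]])
      show "\<bar>(l + l + (shift1 + shift2)) $ k\<bar> < 1" if "k \<noteq> a" "k \<noteq> b" "k \<noteq> c" for k
        using that hbox_nth[OF h, of k] d by (auto simp: abs_less_iff)
    qed (use h d in \<open>auto simp: mem_hbox_vec4 abs_less_iff\<close>)
    then have "(l + l + (shift1 + shift2)) $ a = 0"
      by simp
    then show False
      using h d by (simp add: mem_hbox_vec4)
  qed
qed

end

section \<open>Rescaling and conclusion\<close>

lemma ex1_image:
  assumes "\<exists>!t. t \<in> A \<and> P t" "\<And>t. Q (f t) \<longleftrightarrow> P t"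
  shows "\<exists>!u. u \<in> f ` A \<and> Q u"
  using assms by blast

theorem theorem1p4:
  assumes "CARD('n::finite) \<ge> 3"
    and "(\<epsilon>::real) > 0"
  shows "\<exists>E :: (real^'n) set. E \<in> sets lebesgue \<and>
           cbox (vec 0) (vec 1) \<subseteq> E \<and> E \<subseteq> cbox (vec (-\<epsilon>)) (vec (1 + \<epsilon>)) \<and>
           tiles E \<and> \<not> (\<exists>L. is_lattice L \<and> tiles_with E L)"
proof -
  obtain S :: "'n set" where "card S = 3"
    using assms(1) obtain_subset_with_card_n by blast
  then obtain a b c :: 'n where abc: "a \<noteq> b" "a \<noteq> c" "b \<noteq> c"
    unfolding card_3_iff by blast
  define N where "N = real CARD('n) + 4"
  \<comment> \<open>The bound \<open>\<epsilon> / 6\<close> leaves room for the growth by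
    \<open>6 * d\<close> under the rescaling; the other one yields the smallness required by
    \<open>near_cube\<close>.\<close>
  define d where "d = min (\<epsilon> / 6) (1 / (100 * N))"
  have "1 < N"
    unfolding N_def by simp
  have d_pos: "0 < d" and d_eps: "6 * d \<le> \<epsilon>"
    using assms(2) \<open>1 < N\<close> unfolding d_def by auto
  have "d \<le> 1 / (100 * N)"
    unfolding d_def by simp
  then have "100 * (d * N) \<le> 1"
    using \<open>1 < N\<close> by (simp add: pos_le_divide_eq)
  moreover have "d < d * N"
    using d_pos \<open>1 < N\<close> by simp
  moreover have "16 * N * d = 16 * (d * N)"
    by simp
  ultimately have d_small: "d < 1/100" "16 * N * d < 1"
    using d_pos by linarith+
  interpret near_cube a b c d
    using abc d_pos d_small[unfolded N_def] by unfold_locales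
  \<comment> \<open>The dents keep \<open>E\<close> from containing the closed unit cube. So
    \<open>F\<close> is \<open>E\<close> magnified by \<open>r\<close> and moved back by
    \<open>2 * d\<close> in every coordinate: its core then covers the cube, and \<open>F\<close>
    stays between \<open>- 4 * d\<close> and \<open>1 + 6 * d\<close>.\<close>
  define r where "r = 1 + 6 * d"
  define w :: "real^'n" where "w = vec (2 * d / r)"
  define F where "F = {x. (1 / r) *\<^sub>R x + w \<in> E}"
  have r: "0 < r"
    using d_pos unfolding r_def by simp
  have comp: "((1 / r) *\<^sub>R x + w) $ k = (x $ k + 2 * d) / r" for x k
    unfolding w_def by (simp add: add_divide_distrib)
  have diff: "(1 / r) *\<^sub>R (x - l) + w = ((1 / r) *\<^sub>R x + w) - (1 / r) *\<^sub>R l" for x l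
    by (simp add: algebra_simps)
  have rescale: "(1 / r) *\<^sub>R (r *\<^sub>R (y - w)) + w = y" for y
    using r by simp
  have borel: "F \<in> sets borel"
  proof -
    have "(\<lambda>x. (1 / r) *\<^sub>R x + w) \<in> borel_measurable borel"
      by simp
    from measurable_sets[OF this E_borel] show ?thesis
      unfolding F_def vimage_def by simp
  qed
  have lower: "cbox (vec 0) (vec 1) \<subseteq> F"
  proof
    fix x :: "real^'n"
    assume "x \<in> cbox (vec 0) (vec 1)"
    then have "0 \<le> x $ k" "x $ k \<le> 1" for k
      by (simp_all add: mem_box_cart)
    moreover have "d * r \<le> 2 * d" "1 + 2 * d < (1 - d) * r"
      using d_pos d_small mult_strict_left_mono[OF d_small(1) d_pos] unfolding r_def by (auto simp: algebra_simps)
    ultimately have "d \<le> (x $ k + 2 * d) / r \<and> (x $ k + 2 * d) / r < 1 - d" for k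
      using r by (smt (verit) pos_divide_less_eq pos_le_divide_eq)
    then show "x \<in> F"
      unfolding F_def mem_Collect_eq by (intro core_subset_E) (simp only: comp)
  qed
  have upper: "F \<subseteq> cbox (vec (- \<epsilon>)) (vec (1 + \<epsilon>))"
  proof
    fix x
    assume "x \<in> F"
    then have "- d \<le> (x $ k + 2 * d) / r \<and> (x $ k + 2 * d) / r < 1 + d" for k
      unfolding F_def mem_Collect_eq using E_bounds comp by metis
    then have "- d * r \<le> x $ k + 2 * d \<and> x $ k + 2 * d < (1 + d) * r" for k
      using r by (simp add: pos_le_divide_eq pos_divide_less_eq)
    moreover have "d * r \<le> 2 * d"
      using d_pos d_small mult_strict_left_mono[OF d_small(1) d_pos] unfolding r_def by (auto simp: algebra_simps)
    moreover have "- d * r = - (d * r)" "(1 + d) * r = 1 + 6 * d + d * r"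
      by (simp_all add: r_def algebra_simps)
    ultimately have "- \<epsilon> \<le> x $ k \<and> x $ k \<le> 1 + \<epsilon>" for k
      using d_eps d_pos by (smt (verit, ccfv_threshold))
    then show "x \<in> cbox (vec (- \<epsilon>)) (vec (1 + \<epsilon>))"
      by (simp add: mem_box_cart)
  qed
  then have bounded: "bounded F"
    using bounded_cbox bounded_subset by blast
  have "tiles F"
  proof (rule exact_imp_tiles[OF borel bounded lower])
    show "discrete_set ((\<lambda>t. r *\<^sub>R t) ` T)"
      unfolding discrete_set_def
    proof (intro ballI)
      fix x
      assume "x \<in> (\<lambda>t. r *\<^sub>R t) ` T"
      then obtain s where s: "s \<in> T" "x = r *\<^sub>R s"
        by blast
      then obtain e where e: "e > 0" "\<And>t. t \<in> T \<Longrightarrow> t \<noteq> s \<Longrightarrow> e \<le> dist s t"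
        using discrete_T unfolding discrete_set_def by blast
      have "r * e \<le> dist (r *\<^sub>R s) (r *\<^sub>R t)" if "t \<in> T" "t \<noteq> s" for t
        using e(2)[OF that] r by (simp add: dist_norm flip: scaleR_diff_right)
      then show "\<exists>e>0. \<forall>y\<in>(\<lambda>t. r *\<^sub>R t) ` T. y \<noteq> x \<longrightarrow> e \<le> dist x y"
        using e(1) r s(2) by (intro exI[of _ "r * e"]) auto
    qed
    show "\<exists>!t. t \<in> (\<lambda>t. r *\<^sub>R t) ` T \<and> x - t \<in> F" for x
    proof -
      have "x - r *\<^sub>R t \<in> F \<longleftrightarrow> ((1 / r) *\<^sub>R x + w) - t \<in> E" for t
        unfolding F_def mem_Collect_eq diff using r by simp
      then show ?thesis
        by (intro ex1_image[OF E_tiling[of "(1 / r) *\<^sub>R x + w"]])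
    qed
  qed
  moreover have False if L: "is_lattice L" "tiles_with F L" for L
  proof -
    have clopen: "right_clopen F"
      unfolding F_def using r by (intro right_clopen_affine_vimage right_clopen_E) simp
    \<comment> \<open>Undoing the magnification turns the lattice tiling of \<open>F\<close>, which
      is exact by right-clopenness, into an exact tiling of \<open>E\<close> by a group.\<close>
    interpret near_cube_subgroup_tiling a b c d "(\<lambda>l. (1 / r) *\<^sub>R l) ` L"
    proof unfold_locales
      show "0 \<in> (\<lambda>l. (1 / r) *\<^sub>R l) ` L"
        using is_lattice_zero[OF L(1)] by force
      show "s - t \<in> (\<lambda>l. (1 / r) *\<^sub>R l) ` L"
        if "s \<in> (\<lambda>l. (1 / r) *\<^sub>R l) ` L" "t \<in> (\<lambda>l. (1 / r) *\<^sub>R l) ` L" for s t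
        using that is_lattice_diff[OF L(1)] by (auto simp flip: scaleR_diff_right)
      show "\<exists>!l. l \<in> (\<lambda>l. (1 / r) *\<^sub>R l) ` L \<and> y - l \<in> E" for y
      proof -
        have "r *\<^sub>R (y - w) - l \<in> F \<longleftrightarrow> y - (1 / r) *\<^sub>R l \<in> E" for l
          unfolding F_def mem_Collect_eq diff rescale ..
        then show ?thesis
          by (intro ex1_image[OF lattice_tiling_exact[OF clopen bounded L, of "r *\<^sub>R (y - w)"]]) simp
      qed
    qed
    show False
      by (rule inconsistent)
  qed
  ultimately show ?thesis
    using borel lower upper sets_completionI_sets[of F lborel] by (intro exI[of _ F]) auto
qed

end
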